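(* Let $\tau$ be the Borel probability measure on $\mathbb{R}$ determined by $$\tau(A_{a_1,\dots,a_n})=\frac1{2^n}\qquad\text{for every } n\ge 1 \text{ and every } (a_1,\dots,a_n)\in\{1,3\}^n,$$ where $A_{a_1,\dots,a_n}\subset[0,1]$ is the closed interval of numbers whose continued fraction expansion has initial segment $[0;a_1,\dots,a_n]$. Then $\tau$ is absolutely friendly (with compact support) and $$\tau(\mathbf{BA}(1,1)\cap\operatorname{supp}(\tau))=1 .$$ In particular, it is not true in general that $\tau(\mathcal{K}\cap\mathbf{BA}(M,N))=0$ for an absolutely friendly measure $\tau$ on $\mathbb{R}^{MN}$ supported on a compact set $\mathcal{K}$.
   Context: **Intervals.** $A_{a_1,\dots,a_n}$ is the closed interval with endpoints $[0;a_1,\dots,a_n]$ and $[0;a_1,\dots,a_{n-1},a_n+1]$; for example $A_1=[\frac12,1]$, $A_3=[\frac14,\frac13]$, $A_{1,1,1,3}=[\frac7{11},\frac9{14}]$. The measure $\tau$ is the natural measure on the Cantor-type set $\bigcap_n E_n$, where $E_n$ is the union of the (pairwise disjoint) intervals $A_{a_1,\dots,a_n}$ with $a_i\in\{1,3\}$. **Badly approximable matrices.** For $t\in\mathbb{R}$ let $\langle t\rangle$ be the distance from $t$ to the nearest integer. A real $M\times N$ matrix $A$ is badly approximable if there is a constant $C=C(A)>0$ such that for every $0\neq\mathbf{x}\in\mathbb{Z}^N$ the maximum of $\langle\cdot\rangle$ over the coordinates of $A\mathbf{x}$ is $>C\|\mathbf{x}\|_\infty^{-N/M}$. $\mathbf{BA}(M,N)$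 is the set of all such matrices; $\mathbf{BA}(1,1)$ is the set of badly approximable numbers. **Absolutely friendly measure.** For an affine hyperplane $\mathcal{P}\subset\mathbb{R}^n$ (a point if $n=1$) and $\epsilon>0$ let $\mathcal{P}^{(\epsilon)}$ be the set of points at Euclidean distance $<\epsilon$ from $\mathcal{P}$; $B(\mathbf{x},\rho)$ is the closed Euclidean ball. A finite Borel measure $\tau$ on $\mathbb{R}^n$ is absolutely friendly if there exist positive constants $\rho_0,C,D,a$ such that for every $0<\rho\le\rho_0$ and every $\mathbf{x}\in\operatorname{supp}(\tau)$: (i) for any $0<\epsilon\le\rho$ and any affine hyperplane $\mathcal{P}$, $\tau(B(\mathbf{x},\rho)\cap\mathcal{P}^{(\epsilon)})<C(\epsilon/\rho)^a\,\tau(B(\mathbf{x},\rho))$; (ii) $\tau(B(\mathbf{x},\tfrac12\rho))>D\,\tau(B(\mathbf{x},\rho))$. *)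

theory Defs
  imports "HOL-Probability.Probability"
begin

text \<open>Continued fractions \<open>[0; a\<^sub>1, \<dots>, a\<^sub>n]\<close>, and the interval \<open>A\<close> they span. The interval is
  only meaningful for a nonempty list.\<close>

fun cf :: "nat list \<Rightarrow> real" where
  "cf [] = 0"
| "cf (a # as) = 1 / (real a + cf as)"

definition cf_interval :: "nat list \<Rightarrow> real set" where
  "cf_interval as = closed_segment (cf as) (cf (butlast as @ [last as + 1]))"

definition cf13_measure :: "real measure \<Rightarrow> bool" where
  "cf13_measure \<tau> \<longleftrightarrow> prob_space \<tau> \<and> sets \<tau> = sets borel \<and>
     (\<forall>as. as \<noteq> [] \<longrightarrow> set as \<subseteq> {1, 3} \<longrightarrow> measure \<tau> (cf_interval as) = 1 / 2 ^ length as)"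

text \<open>Support and absolute friendliness are needed both on the type \<open>real\<close> and on \<open>\<real>\<^sup>I\<close> for an
  arbitrary finite index set \<open>I\<close> that is a term and not a type. They are therefore first given
  relative to a distance \<open>d\<close> on the underlying space of the measure and a family \<open>H\<close> of
  hyperplanes.\<close>

definition ball_in :: "('a \<Rightarrow> 'a \<Rightarrow> real) \<Rightarrow> 'a measure \<Rightarrow> 'a \<Rightarrow> real \<Rightarrow> 'a set" where
  "ball_in d \<tau> x \<rho> = {y \<in> space \<tau>. d x y \<le> \<rho>}"

definition nbhd_in :: "('a \<Rightarrow> 'a \<Rightarrow> real) \<Rightarrow> 'a measure \<Rightarrow> 'a set \<Rightarrow> real \<Rightarrow> 'a set" where
  "nbhd_in d \<tau> P \<epsilon> = {y \<in> space \<tau>. \<exists>p\<in>P. d y p < \<epsilon>}"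

definition supp_in :: "('a \<Rightarrow> 'a \<Rightarrow> real) \<Rightarrow> 'a measure \<Rightarrow> 'a set" where
  "supp_in d \<tau> = {x \<in> space \<tau>. \<forall>r>0. measure \<tau> (ball_in d \<tau> x r) > 0}"

definition friendly_in :: "('a \<Rightarrow> 'a \<Rightarrow> real) \<Rightarrow> 'a set set \<Rightarrow> 'a measure \<Rightarrow> bool" where
  "friendly_in d H \<tau> \<longleftrightarrow>
     (\<exists>\<rho>\<^sub>0 C D a. \<rho>\<^sub>0 > 0 \<and> C > 0 \<and> D > 0 \<and> a > 0 \<and>
        (\<forall>\<rho> x. 0 < \<rho> \<longrightarrow> \<rho> \<le> \<rho>\<^sub>0 \<longrightarrow> x \<in> supp_in d \<tau> \<longrightarrow>
           (\<forall>\<epsilon> P. 0 < \<epsilon> \<longrightarrow> \<epsilon> \<le> \<rho> \<longrightarrow> P \<in> H \<longrightarrow>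
              measure \<tau> (ball_in d \<tau> x \<rho> \<inter> nbhd_in d \<tau> P \<epsilon>)
                < C * (\<epsilon> / \<rho>) powr a * measure \<tau> (ball_in d \<tau> x \<rho>)) \<and>
           measure \<tau> (ball_in d \<tau> x (\<rho> / 2)) > D * measure \<tau> (ball_in d \<tau> x \<rho>)))"

text \<open>The real line; its affine hyperplanes are the points.\<close>

definition supp_real :: "real measure \<Rightarrow> real set" where
  "supp_real \<tau> = supp_in dist \<tau>"

definition absolutely_friendly_real :: "real measure \<Rightarrow> bool" where
  "absolutely_friendly_real \<tau> \<longleftrightarrow> finite_measure \<tau> \<and> sets \<tau> = sets borel \<and>
     friendly_in dist {{p} | p. True} \<tau>"

text \<open>The space \<open>\<real>\<^sup>I\<close> of extensional functions on \<open>I\<close>, with Borel sets \<open>PiM I (\<lambda>_. borel)\<close>.\<close>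

definition euclid_dist :: "'i set \<Rightarrow> ('i \<Rightarrow> real) \<Rightarrow> ('i \<Rightarrow> real) \<Rightarrow> real" where
  "euclid_dist I x y = L2_set (\<lambda>i. x i - y i) I"

definition hyperplanes :: "'i set \<Rightarrow> ('i \<Rightarrow> real) set set" where
  "hyperplanes I = {{x \<in> I \<rightarrow>\<^sub>E UNIV. (\<Sum>i\<in>I. c i * x i) = b} | c b. \<exists>i\<in>I. c i \<noteq> 0}"

definition supp_on :: "'i set \<Rightarrow> ('i \<Rightarrow> real) measure \<Rightarrow> ('i \<Rightarrow> real) set" where
  "supp_on I \<tau> = supp_in (euclid_dist I) \<tau>"

definition absolutely_friendly_on :: "'i set \<Rightarrow> ('i \<Rightarrow> real) measure \<Rightarrow> bool" where
  "absolutely_friendly_on I \<tau> \<longleftrightarrow> finite_measure \<tau> \<and> sets \<tau> = sets (PiM I (\<lambda>_. borel)) \<and>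
     friendly_in (euclid_dist I) (hyperplanes I) \<tau>"

definition compact_on :: "'i set \<Rightarrow> ('i \<Rightarrow> real) set \<Rightarrow> bool" where
  "compact_on I K \<longleftrightarrow> compactin (product_topology (\<lambda>_. euclideanreal) I) K"

text \<open>Real \<open>M \<times> N\<close> matrices are the elements of \<open>\<real>\<^sup>I\<close> for \<open>I = {..<M} \<times> {..<N}\<close>. Integer vectors
  are functions of which only the values below \<open>N\<close> matter. Meaningful for \<open>M, N \<ge> 1\<close>.\<close>

definition mat_index :: "nat \<Rightarrow> nat \<Rightarrow> (nat \<times> nat) set" where
  "mat_index M N = {..<M} \<times> {..<N}"

definition BA :: "nat \<Rightarrow> nat \<Rightarrow> (nat \<times> nat \<Rightarrow> real) set" where
  "BA M N = {A \<in> mat_index M N \<rightarrow>\<^sub>E UNIV.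
     \<exists>C>0. \<forall>x :: nat \<Rightarrow> int. (\<exists>j<N. x j \<noteq> 0) \<longrightarrow>
       Max ((\<lambda>i. infdist (\<Sum>j<N. A (i, j) * real_of_int (x j)) \<int>) ` {..<M})
         > C * real_of_int (Max ((\<lambda>j. \<bar>x j\<bar>) ` {..<N})) powr (- (real N / real M))}"

text \<open>\<open>BA 1 1\<close> as a set of real numbers, a number being identified with its \<open>1 \<times> 1\<close> matrix.\<close>

definition BA_real :: "real set" where
  "BA_real = {t. (\<lambda>ij\<in>mat_index 1 1. t) \<in> BA 1 1}"

end

theory Submission imports Defs begin

text \<open>
  The cylinders \<open>A\<^sub>w\<close> are the images of \<open>[0, 1]\<close> under Moebius maps whose distortion is at
  most 2, uniformly in the word \<open>w\<close>. Over the digits 1 and 3, both children of \<open>A\<^sub>w\<close> and the gap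
  between them are therefore comparable to \<open>A\<^sub>w\<close>, and a ball of radius \<open>r\<close> about a point of the
  Cantor set has mass comparable to \<open>2\<^sup>-\<^sup>n\<close>, where \<open>n\<close> is the level at which its cylinders shrink to
  size \<open>r\<close>. This gives the doubling property, and the opposite bound
  \<open>\<tau>(B(x, r/300)) \<le> \<tau>(B(x, r))/2\<close> iterates to the power law \<open>\<tau>(B(x, \<epsilon>)) \<lesssim> (\<epsilon>/r)\<^sup>a \<tau>(B(x, r))\<close>; hyperplanes being
  points, this is absolute friendliness. The support consists of numbers with partial quotients
  at most 3, which are badly approximable.
\<close>

section \<open>Cylinders of continued fractions with digits 1 and 3\<close>

text \<open>The Moebius map taking \<open>x\<close> to [0; a_1, ..., a_n + x]. Raising the last
  digit by one amounts to the tail \<open>x = 1\<close>, so for a nonempty word the endpoints of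
  \<open>cf_interval\<close> are the values at 0 and 1; concatenation of words becomes composition
  of maps.\<close>

fun cf_map :: "nat list \<Rightarrow> real \<Rightarrow> real" where
  "cf_map [] x = x"
| "cf_map (a # w) x = 1 / (real a + cf_map w x)"

lemma cf_map_append: "cf_map (u @ v) x = cf_map u (cf_map v x)"
  by (induction u) auto

lemma cf_eq_cf_map: "cf w = cf_map w 0"
  by (induction w) auto

definition cyl :: "nat list \<Rightarrow> real set" where
  "cyl w = cf_map w ` {0..1}"

definition cyl_length :: "nat list \<Rightarrow> real" where
  "cyl_length w = \<bar>cf_map w 0 - cf_map w 1\<bar>"

lemma cf_map_range:
  assumes "0 \<notin> set w" "x \<in> {0..1}"
  shows "cf_map w x \<in> {0..1}"
  using assms
proof (induction w)
  case (Cons a w)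
  then have "real a \<ge> 1" by (cases a) auto
  with Cons show ?case by (auto simp: divide_le_eq_1)
qed simp

text \<open>The weights are the last two continuant denominators.\<close>
lemma cf_map_distance:
  assumes "0 \<notin> set w"
  shows "\<exists>q q' :: real. q > 0 \<and> 0 \<le> q' \<and> q' \<le> q \<and>
    (\<forall>x\<in>{0..1}. \<forall>y\<in>{0..1}. \<bar>cf_map w x - cf_map w y\<bar> = \<bar>x - y\<bar> / ((q + q' * x) * (q + q' * y)))"
  using assms
proof (induction w rule: rev_induct)
  case Nil
  show ?case by (intro exI[of _ 1] exI[of _ 0]) auto
next
  case (snoc a w)
  then obtain q q' :: real where q: "q > 0" "0 \<le> q'" "q' \<le> q"
    and eq: "\<And>x y. x \<in> {0..1} \<Longrightarrow> y \<in> {0..1} \<Longrightarrow>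
      \<bar>cf_map w x - cf_map w y\<bar> = \<bar>x - y\<bar> / ((q + q' * x) * (q + q' * y))" by auto
  from snoc have a: "real a \<ge> 1" by (cases a) auto
  show ?case
  proof (intro exI conjI ballI)
    \<comment> \<open>These goals fix the witnesses: appending \<open>a\<close> replaces
      (\<open>q\<close>, \<open>q'\<close>) by (\<open>q * a + q'\<close>, \<open>q\<close>). This
      is the continuant recursion, and the reason for inducting from the right end of the
      word.\<close>
    show "q * a + q' > 0" "0 \<le> q" using q a by (auto intro!: add_pos_nonneg mult_pos_pos)
    have "q * 1 \<le> q * a" using q a by (intro mult_left_mono) auto
    then show "q \<le> q * a + q'" using q by linarith
    fix x y :: real assume xy: "x \<in> {0..1}" "y \<in> {0..1}"
    have r: "1 / (a + x) \<in> {0..1}" "1 / (a + y) \<in> {0..1}"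
      using a xy by (auto simp: divide_le_eq_1)
    have p: "a + x > 0" "a + y > 0" using a xy by auto
    have "\<bar>1 / (a + x) - 1 / (a + y)\<bar> = \<bar>(y - x) / ((a + x) * (a + y))\<bar>"
      using p by (simp add: field_simps)
    also have "\<dots> = \<bar>x - y\<bar> / ((a + x) * (a + y))" using p by (simp add: abs_minus_commute)
    finally have d: "\<bar>1 / (a + x) - 1 / (a + y)\<bar> = \<bar>x - y\<bar> / ((a + x) * (a + y))" .
    have e: "(q + q' * (1 / (a + x))) = (q * a + q' + q * x) / (a + x)"
      "(q + q' * (1 / (a + y))) = (q * a + q' + q * y) / (a + y)"
      using p by (auto simp: field_simps)
    have "q * a + q' + q * x > 0" "q * a + q' + q * y > 0"
      using q a xy by (auto intro!: add_pos_nonneg)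
    then show "\<bar>cf_map (w @ [a]) x - cf_map (w @ [a]) y\<bar>
        = \<bar>x - y\<bar> / ((q * a + q' + q * x) * (q * a + q' + q * y))"
      using p by (simp add: cf_map_append eq[OF r, unfolded d e])
  qed
qed

lemma cyl_length_Nil [simp]: "cyl_length [] = 1"
  by (simp add: cyl_length_def)

text \<open>Since \<open>q' \<le> q\<close>, the factors \<open>q + q' * x\<close> lie between
  \<open>q\<close> and \<open>q + q' \<le> 2 * q\<close>. Their product therefore differs by a
  factor of at most 2 from \<open>q * (q + q')\<close>, the reciprocal of the length of the
  cylinder.\<close>

lemma
  assumes "0 \<notin> set w" "x \<in> {0..1}" "y \<in> {0..1}"
  shows cf_map_dist_le: "\<bar>cf_map w x - cf_map w y\<bar> \<le> 2 * cyl_length w * \<bar>x - y\<bar>"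
    and cf_map_dist_ge: "\<bar>cf_map w x - cf_map w y\<bar> \<ge> cyl_length w / 2 * \<bar>x - y\<bar>"
proof -
  obtain q q' :: real where q: "q > 0" "0 \<le> q'" "q' \<le> q"
    and eq: "\<And>x y. x \<in> {0..1} \<Longrightarrow> y \<in> {0..1} \<Longrightarrow>
      \<bar>cf_map w x - cf_map w y\<bar> = \<bar>x - y\<bar> / ((q + q' * x) * (q + q' * y))"
    using cf_map_distance[OF assms(1)] by auto
  have d: "cyl_length w = 1 / (q * (q + q'))"
    unfolding cyl_length_def by (subst eq) auto
  define D where "D = (q + q' * x) * (q + q' * y)"
  have b: "q \<le> q + q' * x" "q \<le> q + q' * y" "q + q' * x \<le> q + q'" "q + q' * y \<le> q + q'"
    using q assms by (auto simp: mult_left_le)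
  have D: "q * q \<le> D" "D \<le> (q + q') * (q + q')"
    unfolding D_def using b q by (auto intro!: mult_mono)
  have "q * q > 0" using q by simp
  have D0: "D > 0" using D(1) \<open>q * q > 0\<close> by linarith
  have s: "q * (q + q') > 0" using q by (auto intro!: mult_pos_pos)
  have l: "q * (q + q') \<le> 2 * (q * q)" using q by (simp add: distrib_left mult_left_mono)
  have u: "(q + q') * (q + q') \<le> 2 * (q * (q + q'))"
    using mult_right_mono[of "q + q'" "2 * q" "q + q'"] q by simp
  have "1 / D \<le> 2 * (1 / (q * (q + q')))"
    using D0 s l D by (simp add: field_simps)
  from mult_right_mono[OF this, of "\<bar>x - y\<bar>"]
  show "\<bar>cf_map w x - cf_map w y\<bar> \<le> 2 * cyl_length w * \<bar>x - y\<bar>"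
    using eq[OF assms(2,3)] unfolding d D_def[symmetric] by simp
  have "1 / (q * (q + q')) / 2 \<le> 1 / D"
    using D0 s u D by (simp add: field_simps)
  from mult_right_mono[OF this, of "\<bar>x - y\<bar>"]
  show "\<bar>cf_map w x - cf_map w y\<bar> \<ge> cyl_length w / 2 * \<bar>x - y\<bar>"
    using eq[OF assms(2,3)] unfolding d D_def[symmetric] by simp
qed

lemma continuous_on_cf_map: "0 \<notin> set w \<Longrightarrow> continuous_on {0..1} (cf_map w)"
proof (induction w)
  case (Cons a w)
  have "real a + cf_map w x \<noteq> 0" if "x \<in> {0..1}" for x
    using cf_map_range[of w x] that Cons by (cases a) auto
  with Cons show ?case by (auto intro!: continuous_intros)
qed simp

text \<open>The map is increasing or decreasing according to the parity of the length. Distances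
  avoid the case distinction: an image point is no farther from either endpoint than the endpoints
  are from each other, hence lies between them. The converse inclusion is connectedness.\<close>

lemma cyl_eq_closed_segment:
  assumes "0 \<notin> set w"
  shows "cyl w = closed_segment (cf_map w 0) (cf_map w 1)"
proof
  obtain q q' :: real where q: "q > 0" "0 \<le> q'" "q' \<le> q"
    and eq: "\<And>x y. x \<in> {0..1} \<Longrightarrow> y \<in> {0..1} \<Longrightarrow>
      \<bar>cf_map w x - cf_map w y\<bar> = \<bar>x - y\<bar> / ((q + q' * x) * (q + q' * y))"
    using cf_map_distance[OF assms(1)] by auto
  show "cyl w \<subseteq> closed_segment (cf_map w 0) (cf_map w 1)"
    unfolding cyl_def
  proof (rule image_subsetI)
    fix x :: real assume x: "x \<in> {0..1}"
    have p: "q + q' * x > 0" "q + q' > 0" using q x by (auto intro: add_pos_nonneg)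
    have e0: "\<bar>cf_map w x - cf_map w 0\<bar> = x / (q * (q + q' * x))"
      and e1: "\<bar>cf_map w x - cf_map w 1\<bar> = (1 - x) / ((q + q' * x) * (q + q'))"
      and e: "\<bar>cf_map w 0 - cf_map w 1\<bar> = 1 / (q * (q + q'))"
      using x by (simp_all add: eq mult.commute)
    have "x * q \<le> q" using x q by (simp add: mult_left_le_one_le)
    then have "x * (q + q') \<le> q + q' * x" by (simp add: algebra_simps)
    then have "x / (q + q' * x) / q \<le> 1 / (q + q') / q"
      using p q by (intro divide_right_mono) (auto simp: divide_simps)
    then have "\<bar>cf_map w x - cf_map w 0\<bar> \<le> \<bar>cf_map w 0 - cf_map w 1\<bar>"
      unfolding e0 e by (simp add: mult.commute)
    moreover have "q * (1 - x) \<le> q + q' * x"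
      using x q mult_nonneg_nonneg[of q x] mult_nonneg_nonneg[of q' x] by (simp add: algebra_simps)
    then have "(1 - x) / (q + q' * x) / (q + q') \<le> 1 / q / (q + q')"
      using p q by (intro divide_right_mono) (auto simp: field_simps)
    then have "\<bar>cf_map w x - cf_map w 1\<bar> \<le> \<bar>cf_map w 0 - cf_map w 1\<bar>"
      unfolding e1 e by simp
    ultimately show "cf_map w x \<in> closed_segment (cf_map w 0) (cf_map w 1)"
      by (auto simp: closed_segment_eq_real_ivl)
  qed
  have "connected (cyl w)"
    unfolding cyl_def by (intro connected_continuous_image continuous_on_cf_map assms) auto
  then have "convex (cyl w)" by (simp only: connected_convex_1)
  then show "closed_segment (cf_map w 0) (cf_map w 1) \<subseteq> cyl w"
    by (intro closed_segment_subset) (auto simp: cyl_def)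
qed

lemma cf_interval_eq_cyl:
  assumes "w \<noteq> []" "0 \<notin> set w"
  shows "cf_interval w = cyl w"
proof -
  have "cf (butlast w @ [last w + 1]) = cf_map (butlast w @ [last w]) 1"
    by (simp add: cf_eq_cf_map cf_map_append add.commute)
  then show ?thesis
    using assms by (simp add: cyl_eq_closed_segment cf_interval_def cf_eq_cf_map)
qed

lemma compact_cyl: "0 \<notin> set w \<Longrightarrow> compact (cyl w)"
  by (simp add: cyl_eq_closed_segment)

lemma cyl_Nil [simp]: "cyl [] = {0..1}"
  by (simp add: cyl_def)

lemma dist_cyl_le:
  assumes "0 \<notin> set w" "x \<in> cyl w" "y \<in> cyl w"
  shows "dist x y \<le> cyl_length w"
  using assms by (auto simp: cyl_eq_closed_segment cyl_length_def dist_real_def closed_segment_eq_real_ivl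
      split: if_splits)

lemma cyl_append_subset: "0 \<notin> set v \<Longrightarrow> cyl (u @ v) \<subseteq> cyl u"
  using cf_map_range[of v] by (auto simp: cyl_def cf_map_append)

lemma cyl_length_append_le:
  assumes "0 \<notin> set (u @ v)"
  shows "cyl_length (u @ v) \<le> 2 * cyl_length u * cyl_length v"
  using cf_map_dist_le[of u "cf_map v 0" "cf_map v 1"] cf_map_range[of v 0] cf_map_range[of v 1] assms
  by (simp add: cyl_length_def cf_map_append)

lemma cyl_length_append_mono:
  assumes "0 \<notin> set (u @ v)"
  shows "cyl_length (u @ v) \<le> cyl_length u"
proof -
  have "cf_map (u @ v) x \<in> cyl u" if "x \<in> {0..1}" for x
    using cyl_append_subset[of v u] assms that by (auto simp: cyl_def)
  then show ?thesis
    using dist_cyl_le[of u "cf_map (u @ v) 0" "cf_map (u @ v) 1"] assms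
    by (simp add: dist_real_def cyl_length_def)
qed

text \<open>The shorter first-level cylinder, [1/4, 1/3], has length 1/12; the lower distortion
  bound costs another factor 2.\<close>

lemma cyl_length_snoc_ge:
  assumes "set w \<subseteq> {1, 3}" "a \<in> {1, 3}"
  shows "cyl_length (w @ [a]) \<ge> cyl_length w / 24"
proof -
  have d: "\<bar>cf_map [a] 0 - cf_map [a] 1\<bar> \<ge> 1 / 12" using assms by auto
  have "0 \<notin> set w" using assms by auto
  then have "cyl_length (w @ [a]) \<ge> cyl_length w / 2 * \<bar>cf_map [a] 0 - cf_map [a] 1\<bar>"
    using cf_map_dist_ge[of w "cf_map [a] 0" "cf_map [a] 1"] assms
    by (auto simp: cyl_length_def cf_map_append)
  moreover have "cyl_length w / 2 * \<bar>cf_map [a] 0 - cf_map [a] 1\<bar> \<ge> cyl_length w / 2 * (1/12)"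
    using d by (intro mult_left_mono) (auto simp: cyl_length_def)
  ultimately show ?thesis by simp
qed

text \<open>One branch need not contract, as 1/(1 + x) has slope -1 at 0, so digits are removed in
  pairs: two branches together contract by at least 4. The factor 2 in the bound pays for the
  unpaired digit of a word of odd length.\<close>

lemma cyl_length_le_power:
  "0 \<notin> set w \<Longrightarrow> cyl_length w \<le> 2 / 2 ^ length w"
proof (induction w rule: induct_list012)
  case (2 a)
  then have "real a \<ge> 1" by (cases a) auto
  then have "1 / real a \<le> 1" "1 / (real a + 1) \<le> 1 / real a" "1 / (real a + 1) \<ge> 0"
    by (auto simp: field_simps)
  then have "\<bar>1 / real a - 1 / (real a + 1)\<bar> \<le> 1" by linarith
  then show ?case by (simp add: cyl_length_def)
next
  case (3 a b w)
  define x y where "x = cf_map w 0" and "y = cf_map w 1"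
  have xy: "x \<in> {0..1}" "y \<in> {0..1}" unfolding x_def y_def using 3 by (intro cf_map_range; simp)+
  from 3 have "a \<noteq> 0" "b \<noteq> 0" by auto
  then have ab: "real a \<ge> 1" "real b \<ge> 1" by simp_all
  have m: "1 * 1 \<le> a * (b + x)" "1 * 1 \<le> a * (b + y)"
    by (intro mult_mono; use ab xy in simp)+
  have p: "b + x > 0" "b + y > 0" using ab xy by auto
  have "1 / (a + 1 / (b + x)) = (b + x) / (a * (b + x) + 1)" "1 / (a + 1 / (b + y)) = (b + y) / (a * (b + y) + 1)"
    using p by (simp_all add: field_simps)
  then have "cyl_length (a # b # w) = \<bar>(b + x) / (a * (b + x) + 1) - (b + y) / (a * (b + y) + 1)\<bar>"
    by (simp add: cyl_length_def x_def y_def)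
  also have "(b + x) / (a * (b + x) + 1) - (b + y) / (a * (b + y) + 1)
      = (x - y) / ((a * (b + x) + 1) * (a * (b + y) + 1))"
    using m by (simp add: diff_frac_eq algebra_simps)
  also have "\<bar>\<dots>\<bar> = \<bar>x - y\<bar> / ((a * (b + x) + 1) * (a * (b + y) + 1))"
    using m by (simp add: abs_mult)
  also have "\<dots> \<le> \<bar>x - y\<bar> / (2 * 2)"
    using m by (intro divide_left_mono mult_mono mult_pos_pos) auto
  also have "\<bar>x - y\<bar> = cyl_length w" by (simp add: x_def y_def cyl_length_def)
  also have "\<dots> / (2 * 2) \<le> (2 / 2 ^ length w) / (2 * 2)"
    using 3 by (intro divide_right_mono) auto
  finally show ?case by simp
qed simp

section \<open>Digit words and the coding of the Cantor set\<close>

definition words :: "nat \<Rightarrow> nat list set" where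
  "words n = {w. set w \<subseteq> {1, 3} \<and> length w = n}"

lemma finite_words: "finite (words n)"
  unfolding words_def by (rule finite_lists_length_eq) simp

lemma card_words: "card (words n) = 2 ^ n"
  unfolding words_def by (subst card_lists_length_eq) (auto simp: numeral_2_eq_2)

lemma words_nonzero: "w \<in> words n \<Longrightarrow> 0 \<notin> set w"
  by (auto simp: words_def)

lemma words_Suc: "w \<in> words (Suc n) \<longleftrightarrow> (\<exists>u\<in>words n. \<exists>a\<in>{1,3}. w = u @ [a])"
proof
  assume "w \<in> words (Suc n)"
  then show "\<exists>u\<in>words n. \<exists>a\<in>{1,3}. w = u @ [a]"
    by (cases w rule: rev_cases) (auto simp: words_def)
qed (auto simp: words_def)

text \<open>Taking reciprocals leaves \<open>a + s = b + t\<close> with \<open>s\<close>,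
  \<open>t\<close> in [0, 1]. The ranges [1, 2] and [3, 4] for the digits 1 and 3 are disjoint, so
  the first digits agree, and then so do the tails. Consecutive digits would allow common
  endpoints.\<close>

lemma cf_map_word_eqD:
  assumes "u \<in> words n" "v \<in> words n" "x \<in> {0..1}" "y \<in> {0..1}" "cf_map u x = cf_map v y"
  shows "u = v"
proof -
  have "length u = length v" using assms by (simp add: words_def)
  moreover have "set u \<subseteq> {1,3}" "set v \<subseteq> {1,3}" using assms by (auto simp: words_def)
  ultimately show ?thesis using assms(5)
  proof (induction u v rule: list_induct2)
    case (Cons a u b v)
    have "cf_map u x \<in> {0..1}" "cf_map v y \<in> {0..1}"
      using Cons assms by (auto intro!: cf_map_range simp del: atLeastAtMost_iff)
    moreover have "real a + cf_map u x = real b + cf_map v y" using Cons by (simp add: divide_simps split: if_splits)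
    ultimately have "a = b \<and> cf_map u x = cf_map v y" using Cons.prems by auto
    then show ?case using Cons by auto
  qed simp
qed

lemma cyl_disjoint: "u \<in> words n \<Longrightarrow> v \<in> words n \<Longrightarrow> u \<noteq> v \<Longrightarrow> cyl u \<inter> cyl v = {}"
  unfolding cyl_def using cf_map_word_eqD[of u n v] by blast

text \<open>The first-level cylinders [1/2, 1] and [1/4, 1/3] are 1/6 apart, and the map of
  \<open>u\<close> keeps at least half of this gap relative to its length.\<close>

lemma cyl_siblings_dist:
  assumes u: "u \<in> words n" and ab: "a \<in> {1, 3}" "b \<in> {1, 3}" "a \<noteq> b"
    and x: "x \<in> cyl (u @ [a])" and y: "y \<in> cyl (u @ [b])"
  shows "dist x y \<ge> cyl_length u / 12"
proof -
  obtain x' y' where x': "x = cf_map u (1 / (real a + x'))" "x' \<in> {0..1}"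
    and y': "y = cf_map u (1 / (real b + y'))" "y' \<in> {0..1}"
    using x y by (auto simp: cyl_def cf_map_append)
  have far: "\<bar>1 / (1 + s) - 1 / (3 + t)\<bar> \<ge> 1/6" if "s \<in> {0..1}" "t \<in> {0..1}" for s t :: real
  proof -
    have "1 / (1 + s) \<ge> 1/2" "1 / (3 + t) \<le> 1/3" using that by (auto simp: field_simps)
    then show ?thesis by simp
  qed
  have d: "\<bar>1 / (real a + x') - 1 / (real b + y')\<bar> \<ge> 1/6"
    using ab x' y' far[of x' y'] far[of y' x'] by (auto simp: abs_minus_commute)
  have "1 / (real a + x') \<in> {0..1}" "1 / (real b + y') \<in> {0..1}"
    using ab x' y' by (auto simp: field_simps)
  from cf_map_dist_ge[OF words_nonzero[OF u] this]
  have "dist x y \<ge> cyl_length u / 2 * \<bar>1 / (real a + x') - 1 / (real b + y')\<bar>"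
    by (simp add: x' y' dist_real_def)
  moreover have "cyl_length u / 2 * \<bar>1 / (real a + x') - 1 / (real b + y')\<bar> \<ge> cyl_length u / 2 * (1/6)"
    using d by (intro mult_left_mono) (auto simp: cyl_length_def)
  ultimately show ?thesis by simp
qed

definition cf13_set :: "real set" where
  "cf13_set = (\<Inter>n. \<Union>w\<in>words n. cyl w)"

text \<open>Well defined at points of level-\<open>n\<close> cylinders, by their disjointness, and
  so on all of \<open>cf13_set\<close>; elsewhere the value is unspecified.\<close>

definition digits :: "nat \<Rightarrow> real \<Rightarrow> nat list" where
  "digits n x = (THE w. w \<in> words n \<and> x \<in> cyl w)"

lemma digits_eqI: "w \<in> words n \<Longrightarrow> x \<in> cyl w \<Longrightarrow> digits n x = w"
  unfolding digits_def using cyl_disjoint[of _ n w] by (intro the_equality) auto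

lemma
  assumes "x \<in> cf13_set"
  shows digits_words: "digits n x \<in> words n" and in_cyl_digits: "x \<in> cyl (digits n x)"
proof -
  obtain w where "w \<in> words n" "x \<in> cyl w" using assms by (auto simp: cf13_set_def)
  then show "digits n x \<in> words n" "x \<in> cyl (digits n x)" using digits_eqI by auto
qed

lemma digits_0: "x \<in> cf13_set \<Longrightarrow> digits 0 x = []"
  using digits_words[of x 0] by (simp add: words_def)

lemma digits_Suc:
  assumes "x \<in> cf13_set"
  shows "\<exists>a\<in>{1,3}. digits (Suc n) x = digits n x @ [a]"
proof -
  obtain u a where ua: "u \<in> words n" "a \<in> {1,3}" "digits (Suc n) x = u @ [a]"
    using digits_words[OF assms, of "Suc n"] unfolding words_Suc by auto
  have "x \<in> cyl u" using in_cyl_digits[OF assms, of "Suc n"] cyl_append_subset[of "[a]" u] ua by auto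
  then have "digits n x = u" using digits_eqI ua by auto
  then show ?thesis using ua by auto
qed

lemma digits_add:
  assumes "x \<in> cf13_set"
  shows "\<exists>v\<in>words m. digits (n + m) x = digits n x @ v"
proof (induction m)
  case 0
  then show ?case by (auto simp: words_def)
next
  case (Suc m)
  then obtain v where v: "v \<in> words m" "digits (n + m) x = digits n x @ v" by auto
  obtain a where "a \<in> {1,3}" "digits (Suc (n + m)) x = digits (n + m) x @ [a]"
    using digits_Suc[OF assms] by blast
  with v show ?case unfolding words_Suc by (intro bexI[of _ "v @ [a]"]) (auto simp: words_Suc)
qed

lemma cyl_length_digits_decseq:
  assumes "x \<in> cf13_set"
  shows "cyl_length (digits (Suc n) x) \<le> cyl_length (digits n x)"
proof -
  obtain a where a: "a \<in> {1,3}" "digits (Suc n) x = digits n x @ [a]"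
    using digits_Suc[OF assms] by blast
  then have "0 \<notin> set (digits n x @ [a])"
    using words_nonzero[OF digits_words[OF assms, of n]] by auto
  from cyl_length_append_mono[OF this] a show ?thesis by simp
qed

lemma cyl_length_digits_Suc_ge:
  assumes "x \<in> cf13_set"
  shows "cyl_length (digits (Suc n) x) \<ge> cyl_length (digits n x) / 24"
  using digits_Suc[OF assms, of n] cyl_length_snoc_ge[of "digits n x"] digits_words[OF assms, of n]
  by (auto simp: words_def)

text \<open>Seven is the first number of digits for which the bound \<open>2 * (2 / 2 ^ m)\<close>
  falls below 1/24. The factor 24 is what turns \<open>12 * r\<close> into \<open>r / 2\<close> in
  the doubling estimate.\<close>

lemma cyl_length_digits_add7:
  assumes "x \<in> cf13_set"
  shows "cyl_length (digits (n + 7) x) \<le> cyl_length (digits n x) / 24"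
proof -
  obtain v where v: "v \<in> words 7" "digits (n + 7) x = digits n x @ v"
    using digits_add[OF assms] by blast
  have nz: "0 \<notin> set (digits n x @ v)"
    using words_nonzero[OF v(1)] words_nonzero[OF digits_words[OF assms, of n]] by auto
  have "cyl_length v \<le> 2 / 2 ^ 7"
    using cyl_length_le_power[OF words_nonzero[OF v(1)]] v(1) by (simp add: words_def)
  then have "2 * cyl_length (digits n x) * cyl_length v \<le> 2 * cyl_length (digits n x) * (2 / 2 ^ 7)"
    by (intro mult_left_mono) (auto simp: cyl_length_def)
  with cyl_length_append_le[OF nz] v(2) have "cyl_length (digits (n + 7) x) \<le> cyl_length (digits n x) / 32"
    by simp
  moreover have "cyl_length (digits n x) \<ge> 0" by (simp add: cyl_length_def)
  ultimately show ?thesis by simp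
qed

text \<open>At the first level where the codes differ, the points lie in sibling cylinders of a
  common parent, which are separated by a gap. That parent has level at most \<open>n\<close>, hence
  is at least as long as the level-\<open>n\<close> cylinder of \<open>x\<close>.\<close>

lemma cf13_set_separation:
  assumes "x \<in> cf13_set" "y \<in> cf13_set" "digits (Suc n) x \<noteq> digits (Suc n) y"
  shows "dist x y \<ge> cyl_length (digits n x) / 12"
  using assms(3)
proof (induction n)
  case 0
  obtain a b where ab: "a \<in> {1,3}" "b \<in> {1,3}" "digits 1 x = [] @ [a]" "digits 1 y = [] @ [b]"
    using digits_Suc[OF assms(1), of 0] digits_Suc[OF assms(2), of 0] assms by (auto simp: digits_0)
  with cyl_siblings_dist[of "[]" 0 a b x y] 0 in_cyl_digits[OF assms(1), of 1] in_cyl_digits[OF assms(2), of 1]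
  show ?case using assms by (auto simp: digits_0 words_def)
next
  case (Suc n)
  show ?case
  proof (cases "digits (Suc n) x = digits (Suc n) y")
    case False
    then have "dist x y \<ge> cyl_length (digits n x) / 12" using Suc by simp
    then show ?thesis using cyl_length_digits_decseq[OF assms(1), of n] by simp
  next
    case True
    obtain a b where ab: "a \<in> {1,3}" "b \<in> {1,3}" "digits (Suc (Suc n)) x = digits (Suc n) x @ [a]"
      "digits (Suc (Suc n)) y = digits (Suc n) y @ [b]"
      using digits_Suc[OF assms(1), of "Suc n"] digits_Suc[OF assms(2), of "Suc n"] by auto
    with cyl_siblings_dist[of "digits (Suc n) x" "Suc n" a b x y] Suc.prems True digits_words[OF assms(1), of "Suc n"]
      in_cyl_digits[OF assms(1), of "Suc (Suc n)"] in_cyl_digits[OF assms(2), of "Suc (Suc n)"]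
    show ?thesis by auto
  qed
qed

lemma closed_cf13_set: "closed cf13_set"
  unfolding cf13_set_def
  by (intro closed_INT ballI closed_UN finite_words compact_imp_closed compact_cyl) (auto dest: words_nonzero)

lemma cf13_set_subset: "cf13_set \<subseteq> {0..1}"
proof -
  have "words 0 = {[]}" by (auto simp: words_def)
  then have "(\<Union>w\<in>words 0. cyl w) = {0..1}" by simp
  then show ?thesis unfolding cf13_set_def by blast
qed

lemma compact_cf13_set: "compact cf13_set"
  using closed_cf13_set cf13_set_subset compact_eq_bounded_closed bounded_subset[OF bounded_closed_interval] by blast

text \<open>The stopping level at which the cylinders around \<open>x\<close> shrink to size
  \<open>r\<close>. The alternative \<open>n = 0\<close> allows for radii that already cover the
  root interval, which has no parent.\<close>

lemma cyl_length_digits_crossing: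
  assumes "x \<in> cf13_set" "r > 0"
  obtains n where "cyl_length (digits n x) \<le> r" "n = 0 \<or> cyl_length (digits (n - 1) x) > r"
proof -
  obtain n where n: "2 / r < 2 ^ n" using real_arch_pow[of 2 "2 / r"] by auto
  have "cyl_length (digits n x) \<le> 2 / 2 ^ n"
    using cyl_length_le_power[OF words_nonzero[OF digits_words[OF assms(1), of n]]] digits_words[OF assms(1), of n]
    by (simp add: words_def)
  also have "\<dots> \<le> r" using n assms by (simp add: field_simps)
  finally have ex: "\<exists>n. cyl_length (digits n x) \<le> r" by blast
  define m where "m = (LEAST n. cyl_length (digits n x) \<le> r)"
  have "cyl_length (digits m x) \<le> r" unfolding m_def using ex by (rule LeastI_ex)
  moreover have "m = 0 \<or> cyl_length (digits (m - 1) x) > r"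
    using not_less_Least[of "m - 1" "\<lambda>n. cyl_length (digits n x) \<le> r"] m_def by (cases m) auto
  ultimately show ?thesis using that by blast
qed

section \<open>Bad approximability\<close>

lemma cf13_set_step:
  assumes "t \<in> cf13_set"
  obtains a s where "a \<in> {1, 3 :: nat}" "s \<in> cf13_set" "t = 1 / (real a + s)"
proof -
  obtain a where a: "a \<in> {1, 3}" "digits 1 t = [a]"
    using digits_Suc[OF assms, of 0] digits_0[OF assms] by auto
  \<comment> \<open>Defining the tail from \<open>t\<close> alone makes one number serve for all
    levels: the set is invariant under removal of the first digit.\<close>
  define s where "s = 1 / t - real a"
  have "s \<in> (\<Union>w\<in>words n. cyl w)" for n
  proof -
    obtain v where v: "v \<in> words n" "digits (1 + n) t = a # v"
      using digits_add[OF assms, where n = 1 and m = n] a by auto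
    then obtain x where x: "x \<in> {0..1}" "t = 1 / (real a + cf_map v x)"
      using in_cyl_digits[OF assms, of "1 + n"] by (auto simp: cyl_def)
    then have "s = cf_map v x" by (simp add: s_def)
    then have "s \<in> cyl v" using x by (simp add: cyl_def)
    with v show ?thesis by blast
  qed
  then have "s \<in> cf13_set" by (auto simp: cf13_set_def)
  moreover have "t = 1 / (real a + s)" by (simp add: s_def)
  ultimately show ?thesis using a that by blast
qed

text \<open>Unfolding \<open>t\<close> one partial quotient at a time reaches the last convergent denominator
  \<open>Q'\<close> not exceeding \<open>q\<close>; partial quotients at most 3 bound the next one by \<open>Q \<le> 4 Q'\<close>.\<close>
lemma cf13_convergent:
  fixes P P' Q Q' q :: int and s t :: real
  assumes "s \<in> cf13_set" "t * (Q + Q' * s) = P + P' * s" "\<bar>P * Q' - P' * Q\<bar> = 1"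
    "0 \<le> Q'" "Q' \<le> Q" "1 \<le> Q" "Q \<le> q"
  shows "\<exists>(R::int) (R'::int) (S::int) (S'::int) r::real. r \<in> {0..1} \<and> t * (S + S' * r) = R + R' * r \<and>
    \<bar>R * S' - R' * S\<bar> = 1 \<and> 1 \<le> S' \<and> S' \<le> q \<and> q < S \<and> S \<le> 4 * S'"
  using assms
\<comment> \<open>The measure uses the sum of both denominators because \<open>Q\<close> alone can
  stall: from \<open>Q = 1\<close>, \<open>Q' = 0\<close> the digit 1 leads to
  \<open>Qn = 1\<close>.\<close>
proof (induction "nat (2 * q - Q - Q')" arbitrary: P P' Q Q' s rule: less_induct)
  case less
  obtain a r where a: "a \<in> {1, 3 :: nat}" and r: "r \<in> cf13_set" and s: "s = 1 / (real a + r)"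
    using cf13_set_step[OF less.prems(1)] by blast
  have r01: "r \<in> {0..1}" using r cf13_set_subset by auto
  have ar: "real a + r > 0" using a r01 by auto
  define Pn Qn where "Pn = P * int a + P'" and "Qn = Q * int a + Q'"
  have "(t * (Q + Q' * s)) * (real a + r) = (P + P' * s) * (real a + r)"
    using less.prems(2) by simp
  moreover have "s * (real a + r) = 1" using ar by (simp add: s)
  ultimately have eq: "t * (Qn + Q * r) = Pn + P * r"
    unfolding Pn_def Qn_def of_int_add of_int_mult of_int_of_nat_eq by algebra
  have "Pn * Q - P * Qn = - (P * Q' - P' * Q)"
    by (simp add: Pn_def Qn_def algebra_simps)
  then have det: "\<bar>Pn * Q - P * Qn\<bar> = 1" using less.prems(3) by (simp add: abs_if split: if_splits)
  have Qn: "Q \<le> Qn" "Qn \<le> 4 * Q" using a less.prems by (auto simp: Qn_def)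
  show ?case
  proof (cases "Qn \<le> q")
    case True
    have "Qn + Q > Q + Q'" using a less.prems by (auto simp: Qn_def)
    then have "nat (2 * q - Qn - Q) < nat (2 * q - Q - Q')"
      using True less.prems Qn by simp
    from less.hyps[OF this r eq det] show ?thesis using less.prems Qn True by simp
  next
    case False
    then show ?thesis using eq det Qn less.prems r01 by (intro exI[of _ Pn] exI[of _ P] exI[of _ Qn] exI[of _ Q] exI[of _ r]) auto
  qed
qed

text \<open>Up to sign, \<open>q * t - p\<close> equals \<open>(v - u * r) / D\<close>, where
  \<open>u\<close>, \<open>v\<close> are the coordinates of (\<open>p\<close>, \<open>q\<close>)
  with respect to two consecutive convergents whose denominators enclose \<open>q\<close>. The
  numerator is at least 1 in modulus and \<open>D\<close> is at most a constant times
  \<open>q\<close>.\<close>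

lemma cf13_set_approximation:
  fixes p q :: int and t :: real
  assumes "t \<in> cf13_set" "q \<ge> 1"
  shows "\<bar>q * t - p\<bar> \<ge> 1 / (8 * q)"
proof -
  obtain R R' S S' :: int and r :: real where r: "(r::real) \<in> {0..1}" and eq: "t * (S + S' * r) = R + R' * r"
    and det: "\<bar>R * S' - R' * S\<bar> = 1" and S: "1 \<le> S'" "S' \<le> q" "q < S" "S \<le> 4 * S'"
    \<comment> \<open>The start consists of the formal convergents 0/1 and 1/0, for which the
      invariant reads \<open>t = s\<close>.\<close>
    using cf13_convergent[where P = 0 and P' = 1 and Q = 1 and Q' = 0 and s = t and t = t and q = q] assms by auto
  define D where "D = S + S' * r"
  \<comment> \<open>From \<open>S \<le> 4 * S' \<le> 4 * q\<close> and \<open>S' * r \<le> q\<close>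
    one gets even \<open>5 * q\<close>; the constant 8 leaves slack.\<close>
  have D: "D > 0" "D \<le> 8 * q"
  proof -
    have "real_of_int S' * r \<le> real_of_int S' * 1" using r S by (intro mult_left_mono) auto
    moreover have "0 \<le> real_of_int S' * r" using r S by auto
    ultimately show "D > 0" "D \<le> 8 * q" using S unfolding D_def by linarith+
  qed
  text \<open>\<open>(p, q)\<close> in the lattice basis \<open>(R, S), (R', S')\<close>, up to the sign of the determinant.\<close>
  define e where "e = R * S' - R' * S"
  have ee: "e * e = 1" using det abs_mult_self_eq[of e] by (simp add: e_def)
  define u v where "u = e * (p * S' - q * R')" and "v = e * (q * R - p * S)"
  have q: "q = S * u + S' * v"
  proof -
    have "S * u + S' * v = q * (e * e)" by (simp add: u_def v_def e_def algebra_simps)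
    then show ?thesis by (simp add: ee)
  qed
  have p: "p = R * u + R' * v"
  proof -
    have "R * u + R' * v = p * (e * e)" by (simp add: u_def v_def e_def algebra_simps)
    then show ?thesis by (simp add: ee)
  qed
  have "(q * t - p) * D = q * (t * D) - p * D" by (simp add: algebra_simps)
  also have "\<dots> = (S * u + S' * v) * (R + R' * r) - (R * u + R' * v) * (S + S' * r)"
    unfolding eq[folded D_def] by (subst q, subst p) (simp add: D_def)
  also have "\<dots> = e * (v - u * r)" by (simp add: e_def algebra_simps)
  finally have "\<bar>q * t - p\<bar> * D = \<bar>real_of_int e\<bar> * \<bar>v - u * r\<bar>"
    using D by (metis abs_mult abs_of_pos)
  moreover have "\<bar>real_of_int e\<bar> = 1" using det by (metis e_def of_int_1 of_int_abs)
  \<comment> \<open>As \<open>1 \<le> q < S\<close>, a nonzero \<open>u\<close> forces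
    \<open>v\<close> to have the opposite sign, so \<open>v\<close> and \<open>- u * r\<close>
    cannot cancel; if \<open>u = 0\<close>, then \<open>v\<close> is nonzero.\<close>
  moreover have "\<bar>v - u * r\<bar> \<ge> 1"
  proof -
    consider "u = 0" | "u \<ge> 1" | "u \<le> -1" by linarith
    then show ?thesis
    proof cases
      case 1
      then have "v \<noteq> 0" using q assms by auto
      then have "\<bar>real_of_int v\<bar> \<ge> 1" by linarith
      then show ?thesis using 1 by simp
    next
      case 2
      have "S * 1 \<le> S * u" using 2 S by (intro mult_left_mono) auto
      then have "S' * v < 0" using q S by linarith
      then have "v \<le> -1" using S by (simp add: mult_less_0_iff)
      then have "real_of_int v \<le> -1" by linarith
      moreover have "u * r \<ge> 0" using 2 r by simp
      ultimately show ?thesis by simp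
    next
      case 3
      have "S * u \<le> S * (-1)" using 3 S by (intro mult_left_mono) auto
      then have "S' * v > 0" using q S assms by linarith
      then have "v \<ge> 1" using S by (simp add: zero_less_mult_iff)
      then have "real_of_int v \<ge> 1" by linarith
      moreover have "u * r \<le> 0" using 3 r by (simp add: mult_nonpos_nonneg)
      ultimately show ?thesis by simp
    qed
  qed
  ultimately have "\<bar>q * t - p\<bar> * D \<ge> 1" by simp
  then have "\<bar>q * t - p\<bar> \<ge> 1 / D" using D by (simp add: divide_le_eq)
  moreover have "1 / D \<ge> 1 / (8 * q)" using D by (intro divide_left_mono) (auto simp: assms)
  ultimately show ?thesis by linarith
qed

lemma cf13_set_subset_BA_real: "cf13_set \<subseteq> BA_real"
proof
  fix t assume t: "t \<in> cf13_set"
  \<comment> \<open>The constant is halved from 1/8 to 1/16 because \<open>BA\<close> asks for a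
    strict inequality.\<close>
  have bound: "infdist (t * real_of_int q) \<int> > 1 / 16 * real_of_int \<bar>q\<bar> powr (- 1)" if "q \<noteq> 0" for q :: int
  proof -
    have "1 / (8 * real_of_int \<bar>q\<bar>) \<le> dist (t * real_of_int q) z" if z: "z \<in> \<int>" for z
    proof -
      obtain p where p: "z = real_of_int p" using z by (auto elim: Ints_cases)
      show ?thesis
      proof (cases "q > 0")
        case True
        then show ?thesis using cf13_set_approximation[OF t, of q p] p by (simp add: dist_real_def mult.commute)
      next
        case False
        with \<open>q \<noteq> 0\<close> show ?thesis using cf13_set_approximation[OF t, of "- q" "- p"] p
          by (simp add: dist_real_def mult.commute abs_minus_commute)
      qed
    qed
    then have "1 / (8 * real_of_int \<bar>q\<bar>) \<le> infdist (t * real_of_int q) \<int>"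
      unfolding infdist_def by (auto intro!: cINF_greatest)
    moreover have "1 / 16 * real_of_int \<bar>q\<bar> powr (- 1) < 1 / (8 * real_of_int \<bar>q\<bar>)"
      using \<open>q \<noteq> 0\<close> by (simp add: powr_minus_divide field_simps)
    ultimately show ?thesis by linarith
  qed
  have "(\<lambda>ij\<in>mat_index 1 1. t) \<in> BA 1 1"
    unfolding BA_def
  proof (intro CollectI conjI exI[of _ "1/16"] allI impI)
    show "(\<lambda>ij\<in>mat_index 1 1. t) \<in> mat_index 1 1 \<rightarrow>\<^sub>E UNIV" by auto
    fix x :: "nat \<Rightarrow> int" assume "\<exists>j<1. x j \<noteq> 0"
    then have "x 0 \<noteq> 0" by auto
    from bound[OF this]
    show "1 / 16 * real_of_int (Max ((\<lambda>j. \<bar>x j\<bar>) ` {..<1})) powr (- (real 1 / real 1))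
      < Max ((\<lambda>i. infdist (\<Sum>j<1. (\<lambda>ij\<in>mat_index 1 1. t) (i, j) * real_of_int (x j)) \<int>) ` {..<1})"
      by (simp add: lessThan_Suc mat_index_def)
  qed simp
  then show "t \<in> BA_real" by (simp add: BA_real_def)
qed

section \<open>Mass of balls\<close>

locale cf13_distribution = prob_space \<tau> for \<tau> :: "real measure" +
  assumes sets_eq_borel [measurable_cong]: "sets \<tau> = sets borel"
    and measure_cf_interval:
      "\<And>w. w \<noteq> [] \<Longrightarrow> set w \<subseteq> {1, 3} \<Longrightarrow> measure \<tau> (cf_interval w) = 1 / 2 ^ length w"
begin

lemma space_eq_UNIV [simp]: "space \<tau> = UNIV"
  using sets_eq_imp_space_eq[OF sets_eq_borel] by simp

lemma cyl_measurable [measurable]: "w \<in> words n \<Longrightarrow> cyl w \<in> sets \<tau>"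
  using compact_cyl[OF words_nonzero, of w n] by (simp add: sets_eq_borel borel_compact)

lemma measure_cyl_Suc: "w \<in> words (Suc n) \<Longrightarrow> measure \<tau> (cyl w) = 1 / 2 ^ Suc n"
  using measure_cf_interval[of w] cf_interval_eq_cyl[OF _ words_nonzero, of w "Suc n"]
  by (force simp: words_def)

lemma disjoint_family_cyl: "disjoint_family_on cyl (words n)"
  using cyl_disjoint by (auto simp: disjoint_family_on_def)

lemma measure_Union_cyl: "measure \<tau> (\<Union>w\<in>words n. cyl w) = (\<Sum>w\<in>words n. measure \<tau> (cyl w))"
  using finite_words disjoint_family_cyl by (intro finite_measure_finite_Union) auto

lemma measure_Union_cyl_Suc: "measure \<tau> (\<Union>w\<in>words (Suc n). cyl w) = 1"
proof -
  have "measure \<tau> (\<Union>w\<in>words (Suc n). cyl w) = (\<Sum>w\<in>words (Suc n). 1 / 2 ^ Suc n)"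
    unfolding measure_Union_cyl by (intro sum.cong measure_cyl_Suc) auto
  then show ?thesis by (simp add: card_words)
qed

text \<open>The defining property of \<open>\<tau>\<close> says nothing about the empty word. There
  [0, 1] has mass 1 because it contains the first-level cylinders, whose masses add up to 1.\<close>

lemma measure_cyl: "w \<in> words n \<Longrightarrow> measure \<tau> (cyl w) = 1 / 2 ^ n"
proof (cases n)
  case 0
  assume "w \<in> words n"
  then have w: "cyl w = {0..1}" using 0 by (simp add: words_def)
  have "(\<Union>w\<in>words 1. cyl w) \<subseteq> {0..1}"
    using cf_map_range by (auto simp: cyl_def dest!: words_nonzero)
  then have "measure \<tau> (\<Union>w\<in>words 1. cyl w) \<le> measure \<tau> {0..1}"
    by (intro finite_measure_mono) (auto simp: sets_eq_borel)
  then show ?thesis using measure_Union_cyl_Suc[of 0] w 0 prob_le_1[of "{0..1}"] by simp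
qed (use measure_cyl_Suc in blast)

lemma AE_Union_cyl: "AE x in \<tau>. x \<in> (\<Union>w\<in>words n. cyl w)"
proof (intro AE_prob_1)
  have "(\<Sum>w\<in>words n. measure \<tau> (cyl w)) = (\<Sum>w\<in>words n. 1 / 2 ^ n)"
    by (intro sum.cong measure_cyl) auto
  then show "measure \<tau> (\<Union>w\<in>words n. cyl w) = 1"
    unfolding measure_Union_cyl by (simp add: card_words)
qed

lemma AE_cf13_set: "AE x in \<tau>. x \<in> cf13_set"
  using AE_Union_cyl unfolding cf13_set_def INT_iff by (simp add: AE_all_countable)

lemma cf13_set_measurable [measurable]: "cf13_set \<in> sets \<tau>"
  using closed_cf13_set by (simp add: sets_eq_borel)

lemma measure_cf13_set: "measure \<tau> cf13_set = 1"
  using AE_cf13_set prob_eq_1[OF cf13_set_measurable] by simp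

lemma measure_disjoint_cf13_set:
  assumes "A \<in> sets \<tau>" "A \<inter> cf13_set = {}"
  shows "measure \<tau> A = 0"
proof -
  have "AE x in \<tau>. x \<in> A \<longleftrightarrow> x \<in> {}"
    using AE_cf13_set by eventually_elim (use assms in auto)
  then show ?thesis using finite_measure_eq_AE[of A "{}"] assms by simp
qed

lemma cball_measurable [measurable]: "cball x r \<in> sets \<tau>"
  by (simp add: sets_eq_borel)

lemma measure_cball_ge:
  assumes "x \<in> cf13_set" "cyl_length (digits n x) \<le> r"
  shows "measure \<tau> (cball x r) \<ge> 1 / 2 ^ n"
proof -
  have "cyl (digits n x) \<subseteq> cball x r"
    using dist_cyl_le[OF words_nonzero[OF digits_words[OF assms(1), of n]] in_cyl_digits[OF assms(1)]] assms(2)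
    by fastforce
  then have "measure \<tau> (cyl (digits n x)) \<le> measure \<tau> (cball x r)"
    by (intro finite_measure_mono) auto
  then show ?thesis using measure_cyl[OF digits_words[OF assms(1)]] by simp
qed

text \<open>The radius is below the gap \<open>cyl_length (digits n x) / 12\<close>, so all points
  of the Cantor set in the ball share the cylinder of \<open>x\<close> at level
  \<open>n + 1\<close>.\<close>

lemma measure_cball_le:
  assumes "x \<in> cf13_set" "12 * r < cyl_length (digits n x)"
  shows "measure \<tau> (cball x r) \<le> 1 / 2 ^ Suc n"
proof -
  have "y \<in> cyl (digits (Suc n) x)" if "y \<in> cf13_set" "y \<in> cball x r" for y
  proof (rule ccontr)
    assume "y \<notin> cyl (digits (Suc n) x)"
    then have "digits (Suc n) x \<noteq> digits (Suc n) y" using in_cyl_digits[OF that(1), of "Suc n"] by auto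
    from cf13_set_separation[OF assms(1) that(1) this] show False using that assms(2) by simp
  qed
  with AE_cf13_set have "measure \<tau> (cball x r) \<le> measure \<tau> (cyl (digits (Suc n) x))"
    by (intro finite_measure_mono_AE cyl_measurable[OF digits_words[OF assms(1)]]) auto
  then show ?thesis using measure_cyl[OF digits_words[OF assms(1)], of "Suc n"] by simp
qed

lemma measure_cball_pos:
  assumes "x \<in> cf13_set" "r > 0"
  shows "measure \<tau> (cball x r) > 0"
proof -
  obtain n where "cyl_length (digits n x) \<le> r" using cyl_length_digits_crossing[OF assms] by blast
  from measure_cball_ge[OF assms(1) this] show ?thesis by (rule less_le_trans[rotated]) simp
qed

text \<open>Let \<open>n\<close> be the stopping level for \<open>12 * r\<close>. The parent
  cylinder is longer than \<open>12 * r\<close>, so the large ball has mass at most 2^-n. Seven more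
  digits shrink the cylinder to \<open>r / 2\<close>, so the half ball has mass at least 2^-(n+7);
  hence 128 = 2^7.\<close>

lemma measure_cball_doubling:
  assumes "x \<in> cf13_set" "r > 0"
  shows "measure \<tau> (cball x r) \<le> 128 * measure \<tau> (cball x (r / 2))"
proof -
  from assms have "12 * r > 0" by simp
  with assms obtain n where n: "cyl_length (digits n x) \<le> 12 * r"
    "n = 0 \<or> cyl_length (digits (n - 1) x) > 12 * r"
    using cyl_length_digits_crossing by blast
  have "measure \<tau> (cball x r) \<le> 1 / 2 ^ n"
    using n(2) measure_cball_le[OF assms(1), of r "n - 1"] by (cases n) auto
  moreover have "measure \<tau> (cball x (r / 2)) \<ge> 1 / 2 ^ (n + 7)"
    using cyl_length_digits_add7[OF assms(1), of n] n(1) by (intro measure_cball_ge[OF assms(1)]) simp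
  ultimately show ?thesis by (simp add: power_add)
qed

text \<open>At the stopping level \<open>n\<close> for \<open>r\<close> the cylinder fits into the
  ball but is still at least \<open>r / 24\<close> long. Any divisor above 12 * 24 = 288 brings the
  small ball below the gap, so it sees at most one of the two children; 300 is a round
  choice.\<close>

lemma measure_cball_halving:
  assumes "x \<in> cf13_set" "0 < r" "r \<le> 1"
  shows "measure \<tau> (cball x (r / 300)) \<le> measure \<tau> (cball x r) / 2"
proof -
  obtain n where n: "cyl_length (digits n x) \<le> r" "n = 0 \<or> cyl_length (digits (n - 1) x) > r"
    using cyl_length_digits_crossing[OF assms(1,2)] by blast
  have "cyl_length (digits n x) \<ge> r / 24"
    using n(2) cyl_length_digits_Suc_ge[OF assms(1), of "n - 1"] assms by (cases n) (auto simp: digits_0)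
  then have "measure \<tau> (cball x (r / 300)) \<le> 1 / 2 ^ Suc n"
    using assms by (intro measure_cball_le[OF assms(1)]) simp
  then show ?thesis using measure_cball_ge[OF assms(1) n(1)] by simp
qed

lemma measure_cball_decay_power:
  assumes "x \<in> cf13_set" "0 < r" "r \<le> 1"
  shows "measure \<tau> (cball x (r / 300 ^ j)) \<le> measure \<tau> (cball x r) / 2 ^ j"
proof (induction j)
  case (Suc j)
  have "r / 300 ^ j \<le> 1" using assms by (simp add: divide_le_eq order_trans[OF _ one_le_power])
  then have "measure \<tau> (cball x (r / 300 ^ j / 300)) \<le> measure \<tau> (cball x (r / 300 ^ j)) / 2"
    using assms by (intro measure_cball_halving) auto
  then show ?case using Suc by (simp add: mult.commute)
qed simp

text \<open>The exponent satisfies 300^(-a) = 1/2, matching the halving factor. With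
  \<open>k\<close> the least power exceeding \<open>r / e\<close>, only \<open>k - 1\<close>
  halvings are available, which costs the factor 2.\<close>

lemma measure_cball_decay:
  assumes "x \<in> cf13_set" "0 < e" "e \<le> r" "r \<le> 1"
  shows "measure \<tau> (cball x e) \<le> 2 * (e / r) powr log 300 2 * measure \<tau> (cball x r)"
proof -
  obtain n where "r / e < 300 ^ n" using real_arch_pow[of 300 "r / e"] by auto
  then have ex: "\<exists>n. r / e < 300 ^ n" by blast
  define k where "k = (LEAST n. r / e < 300 ^ n)"
  have k: "r / e < 300 ^ k" unfolding k_def using ex by (rule LeastI_ex)
  then have "k \<noteq> 0" using assms by (auto intro: ccontr)
  then obtain j where j: "k = Suc j" by (cases k) auto
  have "\<not> r / e < 300 ^ j" using not_less_Least[of j "\<lambda>n. r / e < 300 ^ n"] j k_def by auto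
  then have "e \<le> r / 300 ^ j" using assms by (simp add: field_simps)
  then have "measure \<tau> (cball x e) \<le> measure \<tau> (cball x (r / 300 ^ j))"
    by (intro finite_measure_mono) auto
  also have "\<dots> \<le> measure \<tau> (cball x r) / 2 ^ j"
    using measure_cball_decay_power assms by simp
  also have "\<dots> = 2 * (1 / 2 ^ k) * measure \<tau> (cball x r)" by (simp add: j)
  also have "1 / 2 ^ k = (1 / 300 ^ k) powr log 300 (2::real)"
  proof -
    have "((300::real) ^ k) powr log 300 2 = (300 powr real k) powr log 300 2"
      by (simp add: powr_realpow)
    also have "\<dots> = (300 powr log 300 2) powr real k"
      unfolding powr_powr by (simp only: mult.commute)
    finally have "((300::real) ^ k) powr log 300 2 = (300 powr log 300 2) powr real k" .
    then show ?thesis by (simp add: powr_divide powr_realpow)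
  qed
  also have "2 * \<dots> * measure \<tau> (cball x r) \<le> 2 * (e / r) powr log 300 2 * measure \<tau> (cball x r)"
    using k assms by (intro mult_right_mono mult_left_mono powr_mono2) (auto simp: field_simps)
  finally show ?thesis .
qed

lemma supp_real_eq: "supp_real \<tau> = cf13_set"
proof
  show "cf13_set \<subseteq> supp_real \<tau>"
    using measure_cball_pos by (auto simp: supp_real_def supp_in_def ball_in_def cball_def)
  show "supp_real \<tau> \<subseteq> cf13_set"
  proof (rule subsetI, rule ccontr)
    fix x assume x: "x \<in> supp_real \<tau>" "x \<notin> cf13_set"
    then obtain r where r: "r > 0" "ball x r \<inter> cf13_set = {}"
      using closed_cf13_set unfolding closed_def open_contains_ball by blast
    have "cball x (r / 2) \<inter> cf13_set = {}" using r by (auto simp: set_eq_iff)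
    then have "measure \<tau> (cball x (r / 2)) = 0"
      by (intro measure_disjoint_cf13_set) auto
    moreover have "\<forall>s>0. measure \<tau> (cball x s) > 0"
      using x(1) by (simp add: supp_real_def supp_in_def ball_in_def cball_def)
    then have "measure \<tau> (cball x (r / 2)) > 0" using r(1) half_gt_zero by blast
    ultimately show False by simp
  qed
qed

text \<open>The point \<open>p\<close> may lie off the Cantor set. If the intersection of the two
  balls misses the set, its mass is 0; otherwise it is recentred at a point \<open>y\<close> of the
  set with twice the radius, where the power law applies, and doubling leads back to
  \<open>x\<close>.\<close>

lemma friendly: "friendly_in dist {{p} | p. True} \<tau>"
proof -
  have ball_eq: "ball_in dist \<tau> x r = cball x r" for x r
    by (auto simp: ball_in_def)
  have nbhd_eq: "nbhd_in dist \<tau> {p} e = ball p e" for p e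
    by (auto simp: nbhd_in_def dist_commute)
  have supp_eq: "supp_in dist \<tau> = cf13_set"
    using supp_real_eq by (simp add: supp_real_def)
  have decay: "measure \<tau> (cball x \<rho> \<inter> ball p e) < 40000 * (e / \<rho>) powr log 300 2 * measure \<tau> (cball x \<rho>)"
    if \<rho>: "0 < \<rho>" "\<rho> \<le> 1/2" and x: "x \<in> cf13_set" and e: "0 < e" "e \<le> \<rho>" for \<rho> x e p
  proof (cases "cball x \<rho> \<inter> ball p e \<inter> cf13_set = {}")
    case True
    then have "measure \<tau> (cball x \<rho> \<inter> ball p e) = 0"
      by (intro measure_disjoint_cf13_set) (auto simp: sets_eq_borel)
    then show ?thesis using measure_cball_pos[OF x \<rho>(1)] \<rho> e by simp
  next
    case False
    then obtain y where y: "y \<in> cball x \<rho>" "y \<in> ball p e" "y \<in> cf13_set" by blast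
    have sub1: "cball x \<rho> \<inter> ball p e \<subseteq> cball y (2 * e)"
    proof
      fix z assume "z \<in> cball x \<rho> \<inter> ball p e"
      then show "z \<in> cball y (2 * e)" using y dist_triangle2[of y z p] by (simp add: dist_commute)
    qed
    have sub2: "cball y (2 * \<rho>) \<subseteq> cball x (4 * \<rho>)"
    proof
      fix z assume "z \<in> cball y (2 * \<rho>)"
      then show "z \<in> cball x (4 * \<rho>)" using y \<rho> dist_triangle[of x z y] by simp
    qed
    define c where "c = (e / \<rho>) powr log 300 2"
    have c: "c > 0" using \<rho> e by (simp add: c_def)
    have "measure \<tau> (cball x \<rho> \<inter> ball p e) \<le> measure \<tau> (cball y (2 * e))"
      using sub1 by (intro finite_measure_mono) auto
    also have "\<dots> \<le> 2 * c * measure \<tau> (cball y (2 * \<rho>))"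
      using measure_cball_decay[OF y(3), of "2 * e" "2 * \<rho>"] \<rho> e by (simp add: c_def)
    also have "\<dots> \<le> 2 * c * measure \<tau> (cball x (4 * \<rho>))"
      using sub2 c by (intro mult_left_mono finite_measure_mono) auto
    \<comment> \<open>Two doublings, from \<open>4 * \<rho>\<close> down to \<open>\<rho>\<close>.
      The product 2 * 128^2 = 32768 is rounded up to 40000 for strictness.\<close>
    also have "\<dots> \<le> 2 * c * (128 * (128 * measure \<tau> (cball x \<rho>)))"
      using measure_cball_doubling[OF x, of "4 * \<rho>"] measure_cball_doubling[OF x, of "2 * \<rho>"] \<rho> c
      by (intro mult_left_mono) auto
    also have "\<dots> < 40000 * c * measure \<tau> (cball x \<rho>)"
      using measure_cball_pos[OF x \<rho>(1)] c by simp
    finally show ?thesis by (simp add: c_def)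
  qed
  have doubling: "measure \<tau> (cball x (\<rho> / 2)) > 1/129 * measure \<tau> (cball x \<rho>)"
    if \<rho>: "0 < \<rho>" and x: "x \<in> cf13_set" for \<rho> x
    using measure_cball_doubling[OF x \<rho>] measure_cball_pos[OF x, of "\<rho> / 2"] \<rho> by simp
  \<comment> \<open>The radius bound 1/2 keeps \<open>2 * \<rho>\<close> within the range of the
    power law; 129 in place of 128 makes doubling strict.\<close>
  show ?thesis
    unfolding friendly_in_def ball_eq supp_eq
    by (rule exI[of _ "1/2"], rule exI[of _ 40000], rule exI[of _ "1/129"], rule exI[of _ "log 300 2"])
      (use decay doubling in \<open>auto simp: nbhd_eq\<close>)
qed

end

section \<open>Uniqueness and existence of the measure\<close>

lemma cf13_measure_iff: "cf13_measure \<tau> \<longleftrightarrow> cf13_distribution \<tau>"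
  by (auto simp: cf13_measure_def cf13_distribution_def cf13_distribution_axioms_def)

context cf13_distribution
begin

text \<open>A cylinder avoiding \<open>x\<close> is an interval entirely on one side of
  \<open>x\<close>, so testing the single point \<open>cf_map w 0\<close> decides which
  side.\<close>

lemma measure_cyl_Int_atMost:
  assumes "w \<in> words n" "x \<notin> cyl w"
  shows "measure \<tau> ({..x} \<inter> cyl w) = (if cf_map w 0 \<le> x then 1 / 2 ^ n else 0)"
proof -
  have "cyl w \<subseteq> {..x} \<or> {..x} \<inter> cyl w = {}" "cyl w \<subseteq> {..x} \<longleftrightarrow> cf_map w 0 \<le> x"
    using assms(2) unfolding cyl_eq_closed_segment[OF words_nonzero[OF assms(1)]]
    by (auto simp: closed_segment_eq_real_ivl split: if_splits)
  then show ?thesis using measure_cyl[OF assms(1)] by (auto simp: Int_absorb1)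
qed

lemma cdf_eq_sum: "cdf \<tau> x = (\<Sum>w\<in>words n. measure \<tau> ({..x} \<inter> cyl w))"
proof -
  have "cdf \<tau> x = measure \<tau> (\<Union>w\<in>words n. {..x} \<inter> cyl w)"
    unfolding cdf_def using AE_Union_cyl[of n] finite_words
    by (intro finite_measure_eq_AE) (auto simp: sets_eq_borel intro!: sets.finite_UN
        dest!: cyl_measurable)
  also have "\<dots> = (\<Sum>w\<in>words n. measure \<tau> ({..x} \<inter> cyl w))"
    using finite_words disjoint_family_cyl cyl_measurable
    by (intro finite_measure_finite_Union) (fastforce simp: disjoint_family_on_def sets_eq_borel)+
  finally show ?thesis .
qed

end

text \<open>At each level the two distribution functions can differ at \<open>x\<close> only through
  the cylinder containing \<open>x\<close>. There is at most one, of mass 2^-n, and \<open>n\<close>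
  is arbitrary.\<close>

lemma cf13_measure_unique:
  assumes "cf13_measure \<tau>" "cf13_measure \<sigma>"
  shows "\<tau> = \<sigma>"
proof -
  interpret t: cf13_distribution \<tau> using assms by (simp add: cf13_measure_iff)
  interpret s: cf13_distribution \<sigma> using assms by (simp add: cf13_measure_iff)
  have "cdf \<tau> x = cdf \<sigma> x" for x
  proof -
    have le: "\<bar>cdf \<tau> x - cdf \<sigma> x\<bar> \<le> 1 / 2 ^ n" for n
    proof -
      define h where "h w = measure \<tau> ({..x} \<inter> cyl w) - measure \<sigma> ({..x} \<inter> cyl w)" for w
      have h0: "h w = 0" if "w \<in> words n" "x \<notin> cyl w" for w
        using t.measure_cyl_Int_atMost[OF that] s.measure_cyl_Int_atMost[OF that] by (simp add: h_def)
      have h1: "\<bar>h w\<bar> \<le> 1 / 2 ^ n" if "w \<in> words n" for w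
      proof -
        have "measure \<tau> ({..x} \<inter> cyl w) \<le> 1 / 2 ^ n" "measure \<sigma> ({..x} \<inter> cyl w) \<le> 1 / 2 ^ n"
          using t.finite_measure_mono[of "{..x} \<inter> cyl w" "cyl w"] s.finite_measure_mono[of "{..x} \<inter> cyl w" "cyl w"]
            t.measure_cyl[OF that] s.measure_cyl[OF that] that by auto
        moreover have "measure \<tau> ({..x} \<inter> cyl w) \<ge> 0" "measure \<sigma> ({..x} \<inter> cyl w) \<ge> 0" by auto
        ultimately show ?thesis unfolding h_def by linarith
      qed
      have "cdf \<tau> x - cdf \<sigma> x = (\<Sum>w\<in>words n. h w)"
        by (simp add: h_def t.cdf_eq_sum[of x n] s.cdf_eq_sum[of x n] sum_subtractf)
      also have "\<bar>\<dots>\<bar> \<le> 1 / 2 ^ n"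
      proof (cases "\<exists>v\<in>words n. x \<in> cyl v")
        case True
        then obtain v where v: "v \<in> words n" "x \<in> cyl v" by blast
        then have "(\<Sum>w\<in>words n. h w) = (\<Sum>w\<in>{v}. h w)"
          using cyl_disjoint[OF _ v(1)] by (intro sum.mono_neutral_right finite_words) (auto intro!: h0)
        then show ?thesis using h1[OF v(1)] by simp
      next
        case False
        then have "(\<Sum>w\<in>words n. h w) = 0" by (intro sum.neutral) (auto intro: h0)
        then show ?thesis by simp
      qed
      finally show ?thesis .
    qed
    show ?thesis
    proof (rule ccontr)
      assume "cdf \<tau> x \<noteq> cdf \<sigma> x"
      then have pos: "\<bar>cdf \<tau> x - cdf \<sigma> x\<bar> > 0" by simp
      obtain n where "(1/2) ^ n < \<bar>cdf \<tau> x - cdf \<sigma> x\<bar>" using real_arch_pow_inv[OF pos, of "1/2"] by auto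
      with le[of n] show False by (simp add: power_one_over)
    qed
  qed
  moreover have "real_distribution \<tau>" "real_distribution \<sigma>"
    by (auto simp: real_distribution_def real_distribution_axioms_def t.prob_space_axioms
      s.prob_space_axioms t.sets_eq_borel s.sets_eq_borel)
  ultimately show ?thesis by (intro cdf_unique) auto
qed

section \<open>Existence: the law of a continued fraction with random digits\<close>

definition coin_stream :: "bool stream measure" where
  "coin_stream = stream_space (measure_pmf (bernoulli_pmf (1/2)))"

lemma prob_space_coin_stream: "prob_space coin_stream"
  unfolding coin_stream_def by (intro prob_space.prob_space_stream_space prob_space_measure_pmf)

lemma sets_coin_stream [measurable_cong]: "sets coin_stream = sets (stream_space (count_space UNIV))"
  unfolding coin_stream_def by (intro sets_stream_space_cong) simp

lemma space_coin_stream [simp]: "space coin_stream = UNIV"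
  by (simp add: coin_stream_def space_stream_space)

text \<open>Conditioning on the first coin: the remaining pattern contributes its mass when that
  coin matches \<open>b\<close> and nothing otherwise.\<close>

lemma measure_coin_stream_stake:
  "measure coin_stream {\<omega>. stake (length bs) \<omega> = bs} = 1 / 2 ^ length bs"
proof (induction bs)
  case Nil
  then show ?case using prob_space.prob_space[OF prob_space_coin_stream] by simp
next
  case (Cons b bs)
  have "{\<omega>\<in>space coin_stream. stake (length (b # bs)) \<omega> = b # bs} \<in> sets coin_stream"
    by measurable
  then have "ennreal (measure coin_stream {\<omega>. stake (length (b # bs)) \<omega> = b # bs})
      = (\<integral>\<^sup>+t. measure coin_stream {\<omega>. stake (length (b # bs)) (t ## \<omega>) = b # bs} \<partial>measure_pmf (bernoulli_pmf (1/2)))"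
    using prob_space.prob_stream_space[OF prob_space_measure_pmf, of "bernoulli_pmf (1/2)" "\<lambda>\<omega>. stake (length (b # bs)) \<omega> = b # bs"]
    by (simp flip: coin_stream_def)
  also have "\<dots> = (\<integral>\<^sup>+t. ennreal (1 / 2 ^ length bs) * indicator {b} t \<partial>measure_pmf (bernoulli_pmf (1/2)))"
    using Cons by (intro nn_integral_cong) (auto split: split_indicator)
  also have "\<dots> = ennreal (1 / 2 ^ length bs) * ennreal (1/2)"
    by (cases b) (simp_all add: nn_integral_cmult emeasure_pmf_single)
  also have "\<dots> = ennreal (1 / 2 ^ length (b # bs))"
    by (subst ennreal_mult[symmetric]) auto
  finally show ?case by simp
qed

definition coin_word :: "nat \<Rightarrow> bool stream \<Rightarrow> nat list" where
  "coin_word n \<omega> = map (\<lambda>b. if b then 1 else 3) (stake n \<omega>)"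

text \<open>Written with \<open>lim\<close>, this is measurable before convergence is known, as each
  term depends on finitely many coins. Convergence is established within
  \<open>coin_cf_in_cyl\<close>.\<close>

definition coin_cf :: "bool stream \<Rightarrow> real" where
  "coin_cf \<omega> = lim (\<lambda>n. cf_map (coin_word n \<omega>) 0)"

lemma coin_word_words: "coin_word n \<omega> \<in> words n"
  by (auto simp: coin_word_def words_def)

lemma coin_cf_measurable: "coin_cf \<in> borel_measurable coin_stream"
proof -
  have "(\<lambda>\<omega>. cf_map (coin_word n \<omega>) 0) \<in> borel_measurable coin_stream" for n
    unfolding coin_word_def by measurable
  then show ?thesis unfolding coin_cf_def by measurable
qed

text \<open>From index \<open>n\<close> on, the convergents stay in the level-\<open>n\<close>
  cylinder. These cylinders shrink to length 0, so the sequence is Cauchy, and its limit remains in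
  each of them because they are closed.\<close>

lemma coin_cf_in_cyl: "coin_cf \<omega> \<in> cyl (coin_word n \<omega>)"
proof -
  let ?s = "\<lambda>n. cf_map (coin_word n \<omega>) 0"
  have mem: "?s k \<in> cyl (coin_word n \<omega>)" if "n \<le> k" for n k
  proof -
    have "coin_word k \<omega> = coin_word n \<omega> @ map (\<lambda>b. if b then 1 else 3) (stake (k - n) (sdrop n \<omega>))"
      using that by (simp add: coin_word_def stake_add flip: map_append)
    moreover have "0 \<notin> set (map (\<lambda>b. if b then 1 else 3 :: nat) (stake (k - n) (sdrop n \<omega>)))" by auto
    ultimately have "cyl (coin_word k \<omega>) \<subseteq> cyl (coin_word n \<omega>)"
      using cyl_append_subset by metis
    moreover have "?s k \<in> cyl (coin_word k \<omega>)" by (auto simp: cyl_def)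
    ultimately show ?thesis by blast
  qed
  have "Cauchy ?s"
  proof (rule metric_CauchyI)
    fix e :: real assume e: "e > 0"
    obtain n where n: "2 / e < 2 ^ n" using real_arch_pow[of 2 "2 / e"] by auto
    have "dist (?s k) (?s m) < e" if "k \<ge> n" "m \<ge> n" for k m
    proof -
      have "dist (?s k) (?s m) \<le> cyl_length (coin_word n \<omega>)"
        using that by (intro dist_cyl_le mem words_nonzero[OF coin_word_words])
      also have "\<dots> \<le> 2 / 2 ^ n"
        using cyl_length_le_power[OF words_nonzero[OF coin_word_words[of n \<omega>]]] by (simp add: coin_word_def)
      also have "\<dots> < e" using n e by (simp add: field_simps)
      finally show ?thesis .
    qed
    then show "\<exists>M. \<forall>m\<ge>M. \<forall>n\<ge>M. dist (?s m) (?s n) < e" by blast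
  qed
  then have "?s \<longlonglongrightarrow> coin_cf \<omega>"
    unfolding coin_cf_def by (simp add: Cauchy_convergent_iff convergent_LIMSEQ_iff)
  moreover have "closed (cyl (coin_word n \<omega>))"
    by (intro compact_imp_closed compact_cyl words_nonzero[OF coin_word_words])
  ultimately show ?thesis
    by (intro Lim_in_closed_set[of "cyl (coin_word n \<omega>)" ?s sequentially])
      (auto simp: eventually_sequentially intro!: exI[of _ n] mem)
qed

lemma cf13_measure_exists: "cf13_measure (distr coin_stream borel coin_cf)"
  unfolding cf13_measure_def
proof (intro conjI allI impI)
  interpret prob_space coin_stream by (rule prob_space_coin_stream)
  note [measurable] = coin_cf_measurable
  show "prob_space (distr coin_stream borel coin_cf)" by (rule prob_space_distr) measurable
  show "sets (distr coin_stream borel coin_cf) = sets borel" by simp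
  fix w :: "nat list" assume w: "w \<noteq> []" "set w \<subseteq> {1, 3}"
  define bs where "bs = map (\<lambda>a. a = 1) w"
  have ww: "w \<in> words (length w)" using w by (simp add: words_def)
  have wbs: "w = map (\<lambda>b. if b then 1 else 3) bs"
    unfolding bs_def map_map by (rule map_idI[symmetric]) (use w in auto)
  have inj: "inj (\<lambda>b. if b then 1 else 3 :: nat)" by (auto simp: inj_def)
  have "coin_cf \<omega> \<in> cyl w \<longleftrightarrow> stake (length bs) \<omega> = bs" for \<omega>
  proof -
    \<comment> \<open>Cylinders of one level are disjoint, so lying in \<open>cyl w\<close> forces
      the first coins to spell \<open>w\<close>.\<close>
    have "coin_cf \<omega> \<in> cyl w \<longleftrightarrow> coin_word (length w) \<omega> = w"
      using coin_cf_in_cyl[of \<omega> "length w"] cyl_disjoint[OF coin_word_words ww] by auto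
    also have "\<dots> \<longleftrightarrow> stake (length bs) \<omega> = bs"
      unfolding coin_word_def by (subst (2) wbs, subst inj_map_eq_map[OF inj]) (simp add: bs_def)
    finally show ?thesis .
  qed
  then have "coin_cf -` cyl w = {\<omega>. stake (length bs) \<omega> = bs}" by auto
  moreover have "cyl w \<in> sets borel" using compact_cyl[OF words_nonzero[OF ww]] by (rule borel_compact)
  ultimately have "measure (distr coin_stream borel coin_cf) (cyl w) = 1 / 2 ^ length w"
    using measure_coin_stream_stake[of bs] by (simp add: measure_distr bs_def)
  then show "measure (distr coin_stream borel coin_cf) (cf_interval w) = 1 / 2 ^ length w"
    using cf_interval_eq_cyl[OF w(1) words_nonzero[OF ww]] by simp
qed

section \<open>Transfer to one-by-one matrices\<close>

text \<open>The isometry of the line with the space of 1 by 1 matrices, along which the measure is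
  pushed forward. The restriction to the single index makes the values extensional
  functions.\<close>

definition scalar_matrix :: "real \<Rightarrow> nat \<times> nat \<Rightarrow> real" where
  "scalar_matrix t = (\<lambda>ij\<in>{(0, 0)}. t)"

lemma mat_index_1_1: "mat_index 1 1 = {(0, 0)}"
  by (auto simp: mat_index_def)

lemma scalar_matrix_apply [simp]: "scalar_matrix t (0, 0) = t"
  by (simp add: scalar_matrix_def)

lemma PiE_eq_range_scalar_matrix: "{(0, 0)} \<rightarrow>\<^sub>E UNIV = range scalar_matrix"
proof
  show "{(0, 0)} \<rightarrow>\<^sub>E UNIV \<subseteq> range scalar_matrix"
  proof
    fix y :: "nat \<times> nat \<Rightarrow> real" assume "y \<in> {(0, 0)} \<rightarrow>\<^sub>E UNIV"
    then have "y = scalar_matrix (y (0, 0))"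
      by (auto simp: scalar_matrix_def PiE_def extensional_def fun_eq_iff)
    then show "y \<in> range scalar_matrix" by blast
  qed
  show "range scalar_matrix \<subseteq> {(0, 0)} \<rightarrow>\<^sub>E UNIV"
    unfolding scalar_matrix_def by (intro image_subsetI restrict_PiE_iff[THEN iffD2]) simp
qed

lemma euclid_dist_scalar_matrix: "euclid_dist {(0, 0)} (scalar_matrix s) (scalar_matrix t) = dist s t"
  by (simp add: euclid_dist_def dist_real_def)

lemma scalar_matrix_measurable: "scalar_matrix \<in> borel \<rightarrow>\<^sub>M Pi\<^sub>M {(0, 0)} (\<lambda>_. borel)"
  unfolding scalar_matrix_def by (rule measurable_restrict) simp

lemma scalar_matrix_image_measurable:
  assumes "S \<in> sets borel"
  shows "scalar_matrix ` S \<in> sets (Pi\<^sub>M {(0, 0)} (\<lambda>_. borel))"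
proof -
  have "scalar_matrix ` S = (\<lambda>y. y (0, 0)) -` S \<inter> space (Pi\<^sub>M {(0, 0)} (\<lambda>_. borel))"
    unfolding space_PiM space_borel PiE_eq_range_scalar_matrix by auto
  also have "\<dots> \<in> sets (Pi\<^sub>M {(0, 0)} (\<lambda>_. borel))"
    using assms by (intro measurable_sets[OF measurable_component_singleton]) simp_all
  finally show ?thesis .
qed

lemma hyperplane_scalar_matrix:
  assumes "P \<in> hyperplanes {(0, 0)}"
  obtains p where "P = {scalar_matrix p}"
proof -
  obtain c b where c: "c (0, 0) \<noteq> 0" and P: "P = {x \<in> {(0, 0)} \<rightarrow>\<^sub>E UNIV. c (0, 0) * x (0, 0) = b}"
    using assms by (auto simp: hyperplanes_def)
  have "P = {scalar_matrix (b / c (0, 0))}"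
    unfolding P PiE_eq_range_scalar_matrix using c by (auto simp: field_simps)
  then show ?thesis using that by blast
qed

context cf13_distribution
begin

definition matrix_distr :: "(nat \<times> nat \<Rightarrow> real) measure" where
  "matrix_distr = distr \<tau> (Pi\<^sub>M {(0, 0)} (\<lambda>_. borel)) scalar_matrix"

lemma measure_matrix_distr:
  assumes "S \<in> sets borel"
  shows "measure matrix_distr (scalar_matrix ` S) = measure \<tau> S"
proof -
  have m: "scalar_matrix \<in> \<tau> \<rightarrow>\<^sub>M Pi\<^sub>M {(0, 0)} (\<lambda>_. borel)"
    using scalar_matrix_measurable measurable_cong_sets[OF sets_eq_borel refl] by blast
  have "inj scalar_matrix" by (rule inj_on_inverseI[where g = "\<lambda>y. y (0, 0)"]) simp
  then show ?thesis
    unfolding matrix_distr_def measure_distr[OF m scalar_matrix_image_measurable[OF assms]]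
    by (simp add: inj_vimage_image_eq)
qed

lemma space_matrix_distr: "space matrix_distr = range scalar_matrix"
  by (simp add: matrix_distr_def space_PiM PiE_eq_range_scalar_matrix)

lemma ball_in_matrix_distr:
  "ball_in (euclid_dist {(0, 0)}) matrix_distr (scalar_matrix x) r = scalar_matrix ` ball_in dist \<tau> x r"
  by (auto simp: ball_in_def space_matrix_distr euclid_dist_scalar_matrix)

lemma nbhd_in_matrix_distr:
  "nbhd_in (euclid_dist {(0, 0)}) matrix_distr {scalar_matrix p} e = scalar_matrix ` nbhd_in dist \<tau> {p} e"
  by (auto simp: nbhd_in_def space_matrix_distr euclid_dist_scalar_matrix)

lemma measure_ball_in_matrix_distr:
  "measure matrix_distr (scalar_matrix ` ball_in dist \<tau> x r) = measure \<tau> (ball_in dist \<tau> x r)"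
proof (rule measure_matrix_distr)
  show "ball_in dist \<tau> x r \<in> sets borel" by (simp add: ball_in_def flip: cball_def)
qed

lemma supp_in_matrix_distr:
  "supp_in (euclid_dist {(0, 0)}) matrix_distr = scalar_matrix ` supp_in dist \<tau>"
  by (auto simp: supp_in_def space_matrix_distr ball_in_matrix_distr measure_ball_in_matrix_distr)

text \<open>Balls, neighbourhoods and support are images of those on the line under a bijective
  isometry, and hyperplanes are single points, so the same four constants work.\<close>

lemma friendly_matrix_distr:
  "friendly_in (euclid_dist {(0, 0)}) (hyperplanes {(0 :: nat, 0 :: nat)}) matrix_distr"
proof -
  have inj: "inj scalar_matrix" by (rule inj_on_inverseI[where g = "\<lambda>y. y (0, 0)"]) simp
  have int: "measure matrix_distr (scalar_matrix ` ball_in dist \<tau> x r \<inter> scalar_matrix ` nbhd_in dist \<tau> {p} e)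
      = measure \<tau> (ball_in dist \<tau> x r \<inter> nbhd_in dist \<tau> {p} e)" for x r p e
  proof -
    have "nbhd_in dist \<tau> {p} e = ball p e" by (auto simp: nbhd_in_def dist_commute)
    then have "ball_in dist \<tau> x r \<inter> nbhd_in dist \<tau> {p} e \<in> sets borel"
      by (simp add: ball_in_def flip: cball_def)
    from measure_matrix_distr[OF this] show ?thesis by (simp add: image_Int[OF inj])
  qed
  from friendly obtain \<rho>\<^sub>0 C D a where F: "\<rho>\<^sub>0 > 0 \<and> C > 0 \<and> D > 0 \<and> a > 0 \<and>
        (\<forall>\<rho> x. 0 < \<rho> \<longrightarrow> \<rho> \<le> \<rho>\<^sub>0 \<longrightarrow> x \<in> supp_in dist \<tau> \<longrightarrow>
           (\<forall>\<epsilon> P. 0 < \<epsilon> \<longrightarrow> \<epsilon> \<le> \<rho> \<longrightarrow> P \<in> {{p} | p. True} \<longrightarrow>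
              measure \<tau> (ball_in dist \<tau> x \<rho> \<inter> nbhd_in dist \<tau> P \<epsilon>)
                < C * (\<epsilon> / \<rho>) powr a * measure \<tau> (ball_in dist \<tau> x \<rho>)) \<and>
           measure \<tau> (ball_in dist \<tau> x (\<rho> / 2)) > D * measure \<tau> (ball_in dist \<tau> x \<rho>))"
    unfolding friendly_in_def by (elim exE) (rule that)
  then have pos: "\<rho>\<^sub>0 > 0" "C > 0" "D > 0" "a > 0" by simp_all
  show ?thesis
    unfolding friendly_in_def
  proof (rule exI[of _ \<rho>\<^sub>0], rule exI[of _ C], rule exI[of _ D], rule exI[of _ a], intro conjI pos allI impI)
    fix \<rho> y assume \<rho>: "0 < \<rho>" "\<rho> \<le> \<rho>\<^sub>0" "y \<in> supp_in (euclid_dist {(0, 0)}) matrix_distr"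
    then obtain x where x: "y = scalar_matrix x" "x \<in> supp_in dist \<tau>"
      by (auto simp: supp_in_matrix_distr)
    have db: "measure \<tau> (ball_in dist \<tau> x (\<rho> / 2)) > D * measure \<tau> (ball_in dist \<tau> x \<rho>)"
      using F \<rho>(1,2) x(2) by blast
    have fr: "measure \<tau> (ball_in dist \<tau> x \<rho> \<inter> nbhd_in dist \<tau> {p} \<epsilon>)
        < C * (\<epsilon> / \<rho>) powr a * measure \<tau> (ball_in dist \<tau> x \<rho>)"
      if "0 < \<epsilon>" "\<epsilon> \<le> \<rho>" for \<epsilon> p
      using F \<rho>(1,2) x(2) that by blast
    show "measure matrix_distr (ball_in (euclid_dist {(0, 0)}) matrix_distr y (\<rho> / 2))
      > D * measure matrix_distr (ball_in (euclid_dist {(0, 0)}) matrix_distr y \<rho>)"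
      using db by (simp add: x ball_in_matrix_distr measure_ball_in_matrix_distr)
    fix \<epsilon> and P :: "(nat \<times> nat \<Rightarrow> real) set" assume e: "0 < \<epsilon>" "\<epsilon> \<le> \<rho>" "P \<in> hyperplanes {(0, 0)}"
    then obtain p where p: "P = {scalar_matrix p}" using hyperplane_scalar_matrix by blast
    show "measure matrix_distr (ball_in (euclid_dist {(0, 0)}) matrix_distr y \<rho> \<inter>
        nbhd_in (euclid_dist {(0, 0)}) matrix_distr P \<epsilon>)
      < C * (\<epsilon> / \<rho>) powr a * measure matrix_distr (ball_in (euclid_dist {(0, 0)}) matrix_distr y \<rho>)"
      unfolding x(1) p ball_in_matrix_distr nbhd_in_matrix_distr int measure_ball_in_matrix_distr
      by (rule fr[OF e(1,2)])
  qed
qed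

lemma absolutely_friendly_matrix_distr: "absolutely_friendly_on {(0, 0)} matrix_distr"
proof -
  have "scalar_matrix \<in> \<tau> \<rightarrow>\<^sub>M Pi\<^sub>M {(0, 0)} (\<lambda>_. borel)"
    using scalar_matrix_measurable measurable_cong_sets[OF sets_eq_borel refl] by blast
  then have "finite_measure matrix_distr"
    unfolding matrix_distr_def by (rule finite_measure_distr)
  then show ?thesis
    using friendly_matrix_distr by (simp add: absolutely_friendly_on_def matrix_distr_def)
qed

lemma compact_on_scalar_matrix: "compact K \<Longrightarrow> compact_on {(0, 0)} (scalar_matrix ` K)"
  unfolding compact_on_def scalar_matrix_def
  by (rule image_compactin[where X = euclideanreal])
    (auto simp: continuous_map_componentwise compactin_euclidean_iff)

end

theorem mainTheorem4:
  "(\<exists>!\<tau>. cf13_measure \<tau>) \<and>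
   (\<forall>\<tau>. cf13_measure \<tau> \<longrightarrow>
      absolutely_friendly_real \<tau> \<and> compact (supp_real \<tau>) \<and>
      measure \<tau> (BA_real \<inter> supp_real \<tau>) = 1) \<and>
   \<not> (\<forall>M N \<tau> K. M \<ge> 1 \<longrightarrow> N \<ge> 1 \<longrightarrow>
        absolutely_friendly_on (mat_index M N) \<tau> \<longrightarrow>
        compact_on (mat_index M N) K \<longrightarrow> supp_on (mat_index M N) \<tau> \<subseteq> K \<longrightarrow>
        measure \<tau> (K \<inter> BA M N) = 0)"
proof (intro conjI allI impI)
  show "\<exists>!\<tau>. cf13_measure \<tau>"
    using cf13_measure_exists cf13_measure_unique by blast
next
  fix \<tau> assume "cf13_measure \<tau>"
  then interpret cf13_distribution \<tau> by (simp add: cf13_measure_iff)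
  show "absolutely_friendly_real \<tau>"
    using friendly finite_measure_axioms sets_eq_borel by (simp add: absolutely_friendly_real_def)
  show "compact (supp_real \<tau>)" using compact_cf13_set by (simp add: supp_real_eq)
  show "measure \<tau> (BA_real \<inter> supp_real \<tau>) = 1"
    using measure_cf13_set cf13_set_subset_BA_real by (simp add: supp_real_eq Int_absorb1)
next
  interpret cf13_distribution "distr coin_stream borel coin_cf"
    using cf13_measure_exists by (simp add: cf13_measure_iff)
  \<comment> \<open>The counterexample has \<open>M = N = 1\<close> and takes for \<open>K\<close>
    the support itself, which consists of badly approximable numbers and so yields mass 1 instead of
    0.\<close>
  let ?K = "scalar_matrix ` cf13_set"
  have "supp_on (mat_index 1 1) matrix_distr \<subseteq> ?K"
    using supp_real_eq unfolding mat_index_1_1 by (simp add: supp_on_def supp_in_matrix_distr supp_real_def)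
  moreover have "?K \<inter> BA 1 1 = ?K"
    using cf13_set_subset_BA_real unfolding BA_real_def mat_index_1_1 scalar_matrix_def by blast
  then have "measure matrix_distr (?K \<inter> BA 1 1) = 1"
    using measure_matrix_distr[of cf13_set] measure_cf13_set closed_cf13_set by simp
  moreover have "compact_on (mat_index 1 1) ?K" "absolutely_friendly_on (mat_index 1 1) matrix_distr"
    unfolding mat_index_1_1
    by (rule compact_on_scalar_matrix[OF compact_cf13_set] absolutely_friendly_matrix_distr)+
  ultimately show "\<not> (\<forall>M N \<tau> K. M \<ge> 1 \<longrightarrow> N \<ge> 1 \<longrightarrow>
        absolutely_friendly_on (mat_index M N) \<tau> \<longrightarrow>
        compact_on (mat_index M N) K \<longrightarrow> supp_on (mat_index M N) \<tau> \<subseteq> K \<longrightarrow>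
        measure \<tau> (K \<inter> BA M N) = 0)"
    by (metis order_refl zero_neq_one)
qed

end
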